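(* Let $(X,\tau)$ be an extended locally convex space with finest locally convex topology $\tau_F$ and weak topology $\tau_w$. If $\tau_F=\tau_w$, then the quotient vector space $X/X_{fin}^\rho$ is finite dimensional for every continuous extended seminorm $\rho$ on $(X,\tau)$.
   Context: Vector spaces are over $\mathbb{K}$, where $\mathbb{K}$ is $\mathbb{R}$ or $\mathbb{C}$. An extended seminorm on $X$ is a map $\rho:X\to[0,\infty]$ with $\rho(\alpha x)=|\alpha|\rho(x)$ (convention $0\cdot\infty=0$) and $\rho(x+y)\le\rho(x)+\rho(y)$. An extended locally convex space (elcs) is a vector space $X$ with a group topology $\tau$ induced by a family $\{\rho_i\}_{i\in I}$ of extended seminorms, i.e. the sets $\{y:\rho_i(y-x)<\varepsilon \text{ for all } i\in J\}$ with $\varepsilon>0$ and $J\subseteq I$ finite form a neighborhood base at $x$. For a continuous extended seminorm $\rho$, $X_{fin}^\rho=\{x\in X:\rho(x)<\infty\}$. $X^*$ is the set of all $\tau$-continuous linear functionals $X\to\mathbb{K}$. The finest locally convex topology (flc topology) $\tau_F$ of $(X,\tau)$ is the finest locally convex topology on $X$ (i.e. one induced by finite-valued seminorms) that is coarser than $\tau$. The weak topology $\tau_w$ on $X$ is induced by the seminorms $x\mapsto|f(x)|$, $f\in X^*$. *)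

theory Defs
  imports "HOL-Analysis.Analysis" "HOL-Library.Set_Algebras"
begin

text \<open>
  The scalar field is a type \<open>'k::real_normed_field\<close>. The norm of this class is multiplicative, so
  by Gelfand-Mazur its instances are, up to isometric isomorphism, exactly \<open>real\<close> and \<open>complex\<close>.
  A vector space is a type \<open>'a::ab_group_add\<close> with a scaling satisfying \<^locale>\<open>vector_space\<close>.
\<close>

text \<open>On \<^typ>\<open>ennreal\<close> we have \<open>0 * \<infinity> = 0\<close>, the convention used for extended seminorms.\<close>

definition ext_seminorm :: "('k::real_normed_field \<Rightarrow> 'a::ab_group_add \<Rightarrow> 'a) \<Rightarrow> ('a \<Rightarrow> ennreal) \<Rightarrow> bool"
  where "ext_seminorm smul \<rho> \<longleftrightarrow>
    (\<forall>\<alpha> x. \<rho> (smul \<alpha> x) = ennreal (norm \<alpha>) * \<rho> x) \<and> (\<forall>x y. \<rho> (x + y) \<le> \<rho> x + \<rho> y)"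

definition fin_part :: "('a \<Rightarrow> ennreal) \<Rightarrow> 'a set"
  where "fin_part \<rho> = {x. \<rho> x < \<infinity>}"

definition snball :: "('a::ab_group_add \<Rightarrow> ennreal) set \<Rightarrow> real \<Rightarrow> 'a \<Rightarrow> 'a set"
  where "snball J \<epsilon> x = {y. \<forall>\<rho>\<in>J. \<rho> (y - x) < ennreal \<epsilon>}"

text \<open>The topology induced by a family \<open>P\<close> of extended seminorms; see \<open>snball_nhd_base\<close> below. It is
  automatically a group topology (\<open>seminorm_topology_group\<close>).\<close>

definition seminorm_topology :: "('a::ab_group_add \<Rightarrow> ennreal) set \<Rightarrow> 'a topology"
  where "seminorm_topology P = topology (\<lambda>U. \<forall>x\<in>U. \<exists>J \<epsilon>. finite J \<and> J \<subseteq> P \<and> \<epsilon> > 0 \<and> snball J \<epsilon> x \<subseteq> U)"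

definition elcs :: "('k::real_normed_field \<Rightarrow> 'a::ab_group_add \<Rightarrow> 'a) \<Rightarrow> 'a topology \<Rightarrow> bool"
  where "elcs smul \<tau> \<longleftrightarrow> vector_space smul \<and>
    (\<exists>P. (\<forall>\<rho>\<in>P. ext_seminorm smul \<rho>) \<and> \<tau> = seminorm_topology P)"

definition locally_convex_topology ::
  "('k::real_normed_field \<Rightarrow> 'a::ab_group_add \<Rightarrow> 'a) \<Rightarrow> 'a topology \<Rightarrow> bool"
  where "locally_convex_topology smul \<tau> \<longleftrightarrow>
    (\<exists>P. (\<forall>\<rho>\<in>P. ext_seminorm smul \<rho> \<and> (\<forall>x. \<rho> x < \<infinity>)) \<and> \<tau> = seminorm_topology P)"

definition coarser_topology :: "'a topology \<Rightarrow> 'a topology \<Rightarrow> bool"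
  where "coarser_topology \<sigma> \<tau> \<longleftrightarrow> (\<forall>U. openin \<sigma> U \<longrightarrow> openin \<tau> U)"

definition is_flc_topology ::
  "('k::real_normed_field \<Rightarrow> 'a::ab_group_add \<Rightarrow> 'a) \<Rightarrow> 'a topology \<Rightarrow> 'a topology \<Rightarrow> bool"
  where "is_flc_topology smul \<tau> \<tau>F \<longleftrightarrow>
    locally_convex_topology smul \<tau>F \<and> coarser_topology \<tau>F \<tau> \<and>
    (\<forall>\<sigma>. locally_convex_topology smul \<sigma> \<and> coarser_topology \<sigma> \<tau> \<longrightarrow> coarser_topology \<sigma> \<tau>F)"

definition continuous_dual ::
  "('k::real_normed_field \<Rightarrow> 'a::ab_group_add \<Rightarrow> 'a) \<Rightarrow> 'a topology \<Rightarrow> ('a \<Rightarrow> 'k) set"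
  where "continuous_dual smul \<tau> =
    {f. Vector_Spaces.linear smul (*) f \<and> continuous_map \<tau> euclidean f}"

definition weak_topology ::
  "('k::real_normed_field \<Rightarrow> 'a::ab_group_add \<Rightarrow> 'a) \<Rightarrow> 'a topology \<Rightarrow> 'a topology"
  where "weak_topology smul \<tau> =
    seminorm_topology ((\<lambda>f x. ennreal (norm (f x))) ` continuous_dual smul \<tau>)"

text \<open>
  The quotient by a subspace \<open>W\<close>, as a set of cosets \<open>x +o W\<close>. Addition of cosets is the
  elementwise addition of sets, and the zero is \<open>W\<close>. In the scaling of cosets, the summand \<open>W\<close>
  matters only for the scalar \<open>0\<close>.
\<close>

definition quotient_space :: "'a::ab_group_add set \<Rightarrow> 'a set set"
  where "quotient_space W = range (\<lambda>x. x +o W)"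

definition quotient_scale ::
  "('k \<Rightarrow> 'a::ab_group_add \<Rightarrow> 'a) \<Rightarrow> 'a set \<Rightarrow> 'k \<Rightarrow> 'a set \<Rightarrow> 'a set"
  where "quotient_scale smul W c A = smul c ` A + W"

text \<open>
  Some finite set of cosets spans the quotient. The sum below is taken in the additive monoid of
  sets, whose zero is \<open>{0}\<close>; adding the zero coset \<open>W\<close> gives the right value to the empty sum and
  changes nothing otherwise.
\<close>

definition finite_dim_quotient ::
  "('k \<Rightarrow> 'a::ab_group_add \<Rightarrow> 'a) \<Rightarrow> 'a set \<Rightarrow> bool"
  where "finite_dim_quotient smul W \<longleftrightarrow>
    (\<exists>S. finite S \<and> S \<subseteq> quotient_space W \<and>
      (\<forall>A\<in>quotient_space W. \<exists>c. A = W + (\<Sum>B\<in>S. quotient_scale smul W (c B) B)))"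

lemma snball_mono:
  assumes "J \<subseteq> K" "\<delta> \<le> \<epsilon>"
  shows "snball K \<delta> x \<subseteq> snball J \<epsilon> x"
proof
  fix y assume "y \<in> snball K \<delta> x"
  then have "\<rho> (y - x) < ennreal \<delta>" if "\<rho> \<in> J" for \<rho>
    using assms(1) that unfolding snball_def by blast
  then show "y \<in> snball J \<epsilon> x"
    using ennreal_leI[OF assms(2)] unfolding snball_def by (blast intro: less_le_trans)
qed

lemma openin_seminorm_topology:
  "openin (seminorm_topology P) U \<longleftrightarrow>
    (\<forall>x\<in>U. \<exists>J \<epsilon>. finite J \<and> J \<subseteq> P \<and> \<epsilon> > 0 \<and> snball J \<epsilon> x \<subseteq> U)"
proof -
  let ?L = "\<lambda>U. \<forall>x\<in>U. \<exists>J \<epsilon>. finite J \<and> J \<subseteq> P \<and> \<epsilon> > 0 \<and> snball J \<epsilon> x \<subseteq> U"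
  have "istopology ?L"
    unfolding istopology_def
  proof (intro conjI allI impI ballI)
    fix S T x assume S: "?L S" and T: "?L T" and x: "x \<in> S \<inter> T"
    obtain J \<epsilon> where J: "finite J" "J \<subseteq> P" "\<epsilon> > 0" "snball J \<epsilon> x \<subseteq> S" using bspec[OF S, of x] x by auto
    obtain K \<delta> where K: "finite K" "K \<subseteq> P" "\<delta> > 0" "snball K \<delta> x \<subseteq> T" using bspec[OF T, of x] x by auto
    have "snball (J \<union> K) (min \<epsilon> \<delta>) x \<subseteq> snball J \<epsilon> x \<inter> snball K \<delta> x"
      by (intro Int_greatest snball_mono) auto
    then have "snball (J \<union> K) (min \<epsilon> \<delta>) x \<subseteq> S \<inter> T"
      using J(4) K(4) by blast
    then show "\<exists>J \<epsilon>. finite J \<and> J \<subseteq> P \<and> \<epsilon> > 0 \<and> snball J \<epsilon> x \<subseteq> S \<inter> T"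
      using J(1-3) K(1-3) by (intro exI[of _ "J \<union> K"] exI[of _ "min \<epsilon> \<delta>"]) simp
  next
    fix \<K> x assume \<K>: "\<forall>K\<in>\<K>. ?L K" and "x \<in> \<Union>\<K>"
    then obtain K where K: "K \<in> \<K>" "x \<in> K" by blast
    with \<K> have "\<exists>J \<epsilon>. finite J \<and> J \<subseteq> P \<and> \<epsilon> > 0 \<and> snball J \<epsilon> x \<subseteq> K" by simp
    with K(1) show "\<exists>J \<epsilon>. finite J \<and> J \<subseteq> P \<and> \<epsilon> > 0 \<and> snball J \<epsilon> x \<subseteq> \<Union>\<K>"
      by (meson Union_upper subset_trans)
  qed
  then show ?thesis
    by (simp add: seminorm_topology_def topology_inverse')
qed

lemma openin_seminorm_topologyE:
  assumes "openin (seminorm_topology P) U" "x \<in> U"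
  obtains J \<epsilon> where "finite J" "J \<subseteq> P" "\<epsilon> > 0" "snball J \<epsilon> x \<subseteq> U"
proof -
  have "\<exists>J \<epsilon>. finite J \<and> J \<subseteq> P \<and> \<epsilon> > 0 \<and> snball J \<epsilon> x \<subseteq> U"
    using assms by (simp add: openin_seminorm_topology)
  then show ?thesis using that by auto
qed

lemma topspace_seminorm_topology [simp]: "topspace (seminorm_topology P) = UNIV"
proof -
  have "openin (seminorm_topology P) UNIV"
    unfolding openin_seminorm_topology by (auto intro!: exI[of _ "{}"] exI[of _ 1])
  from openin_subset[OF this] show ?thesis by auto
qed

lemma ext_seminorm_zero:
  assumes "vector_space smul" "ext_seminorm smul \<rho>"
  shows "\<rho> 0 = 0"
proof -
  interpret vector_space smul by fact
  have "\<rho> (smul 0 0) = ennreal (norm (0::'a)) * \<rho> 0"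
    using assms(2) unfolding ext_seminorm_def by blast
  then show ?thesis by simp
qed

lemma ext_seminorm_minus:
  assumes "vector_space smul" "ext_seminorm smul \<rho>"
  shows "\<rho> (- x) = \<rho> x"
proof -
  interpret vector_space smul by fact
  have "\<rho> (smul (-1) x) = ennreal (norm (-1::'a)) * \<rho> x"
    using assms(2) unfolding ext_seminorm_def by blast
  then show ?thesis by simp
qed

lemma snball_self:
  assumes "vector_space smul" "\<forall>\<rho>\<in>J. ext_seminorm smul \<rho>" "\<epsilon> > 0"
  shows "x \<in> snball J \<epsilon> x"
proof -
  have "\<rho> (x - x) < ennreal \<epsilon>" if "\<rho> \<in> J" for \<rho>
    using ext_seminorm_zero[OF assms(1), of \<rho>] assms(2,3) that by simp
  then show ?thesis by (simp only: snball_def) blast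
qed

lemma openin_snball:
  assumes "vector_space smul" "\<forall>\<rho>\<in>P. ext_seminorm smul \<rho>" "finite J" "J \<subseteq> P"
  shows "openin (seminorm_topology P) (snball J \<epsilon> x)"
  unfolding openin_seminorm_topology
proof
  fix y assume y: "y \<in> snball J \<epsilon> x"
  have "\<exists>\<delta>>0. \<forall>\<rho>\<in>J. \<rho> (y - x) + ennreal \<delta> \<le> ennreal \<epsilon>"
    using \<open>finite J\<close> y
  proof (induction J)
    case empty then show ?case by (auto intro: exI[of _ 1])
  next
    case (insert \<rho> J)
    have "y \<in> snball J \<epsilon> x"
      using insert.prems by (simp add: snball_def)
    then obtain \<delta> where \<delta>: "\<delta> > 0" "\<forall>\<rho>\<in>J. \<rho> (y - x) + ennreal \<delta> \<le> ennreal \<epsilon>"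
      using insert.IH by blast
    have lt: "\<rho> (y - x) < ennreal \<epsilon>"
      using insert.prems by (simp add: snball_def)
    then obtain r where r: "\<rho> (y - x) = ennreal r" "r \<ge> 0"
      by (cases "\<rho> (y - x)") auto
    with lt have "r < \<epsilon>" by (simp add: ennreal_less_iff)
    let ?d = "min \<delta> (\<epsilon> - r)"
    have "\<rho> (y - x) + ennreal ?d \<le> ennreal \<epsilon>"
    proof -
      have "\<rho> (y - x) + ennreal ?d = ennreal (r + ?d)"
        using r \<open>r < \<epsilon>\<close> \<delta>(1) by (subst r(1), subst ennreal_plus) auto
      also have "\<dots> \<le> ennreal \<epsilon>"
        by (intro ennreal_leI) simp
      finally show ?thesis .
    qed
    moreover have "\<forall>\<rho>\<in>J. \<rho> (y - x) + ennreal ?d \<le> ennreal \<epsilon>"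
    proof
      fix \<rho>' assume "\<rho>' \<in> J"
      have "\<rho>' (y - x) + ennreal ?d \<le> \<rho>' (y - x) + ennreal \<delta>"
        by (intro add_left_mono ennreal_leI) simp
      also have "\<dots> \<le> ennreal \<epsilon>" using \<delta>(2) \<open>\<rho>' \<in> J\<close> by blast
      finally show "\<rho>' (y - x) + ennreal ?d \<le> ennreal \<epsilon>" .
    qed
    ultimately show ?case
      using \<delta>(1) \<open>r < \<epsilon>\<close> by (intro exI[of _ ?d]) auto
  qed
  then obtain \<delta> where \<delta>: "\<delta> > 0" "\<forall>\<rho>\<in>J. \<rho> (y - x) + ennreal \<delta> \<le> ennreal \<epsilon>" by blast
  have "snball J \<delta> y \<subseteq> snball J \<epsilon> x"
  proof
    fix z assume z: "z \<in> snball J \<delta> y"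
    show "z \<in> snball J \<epsilon> x"
      unfolding snball_def
    proof (intro CollectI ballI)
      fix \<rho> assume \<rho>: "\<rho> \<in> J"
      have "\<rho> ((y - x) + (z - y)) \<le> \<rho> (y - x) + \<rho> (z - y)"
        using assms(2,4) \<rho> unfolding ext_seminorm_def by blast
      also have "\<dots> < \<rho> (y - x) + ennreal \<delta>"
      proof -
        have "\<rho> (y - x) < ennreal \<epsilon>" using y \<rho> by (auto simp: snball_def)
        then have "\<rho> (y - x) \<noteq> top" by (metis not_less top_greatest)
        moreover have "\<rho> (z - y) < ennreal \<delta>" using z \<rho> by (auto simp: snball_def)
        ultimately show ?thesis by (simp add: ennreal_add_left_cancel_less)
      qed
      also have "\<dots> \<le> ennreal \<epsilon>" using \<delta>(2) \<rho> by blast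
      finally show "\<rho> (z - x) < ennreal \<epsilon>" by simp
    qed
  qed
  then show "\<exists>J' \<delta>. finite J' \<and> J' \<subseteq> P \<and> \<delta> > 0 \<and> snball J' \<delta> y \<subseteq> snball J \<epsilon> x"
    using assms(3,4) \<delta>(1) by blast
qed

lemma snball_nhd_base:
  assumes "vector_space smul" "\<forall>\<rho>\<in>P. ext_seminorm smul \<rho>"
  shows "(\<exists>U. openin (seminorm_topology P) U \<and> x \<in> U \<and> U \<subseteq> N) \<longleftrightarrow>
    (\<exists>J \<epsilon>. finite J \<and> J \<subseteq> P \<and> \<epsilon> > 0 \<and> snball J \<epsilon> x \<subseteq> N)"
proof
  assume "\<exists>J \<epsilon>. finite J \<and> J \<subseteq> P \<and> \<epsilon> > 0 \<and> snball J \<epsilon> x \<subseteq> N"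
  then obtain J \<epsilon> where J: "finite J" "J \<subseteq> P" "\<epsilon> > 0" "snball J \<epsilon> x \<subseteq> N" by blast
  moreover have "x \<in> snball J \<epsilon> x"
    using J assms by (intro snball_self) blast+
  ultimately show "\<exists>U. openin (seminorm_topology P) U \<and> x \<in> U \<and> U \<subseteq> N"
    using openin_snball[OF assms J(1,2), of \<epsilon> x] by auto
next
  assume "\<exists>U. openin (seminorm_topology P) U \<and> x \<in> U \<and> U \<subseteq> N"
  then obtain U where U: "openin (seminorm_topology P) U" "x \<in> U" "U \<subseteq> N" by blast
  then have "\<exists>J \<epsilon>. finite J \<and> J \<subseteq> P \<and> \<epsilon> > 0 \<and> snball J \<epsilon> x \<subseteq> U"
    by (simp add: openin_seminorm_topology)
  with U(3) show "\<exists>J \<epsilon>. finite J \<and> J \<subseteq> P \<and> \<epsilon> > 0 \<and> snball J \<epsilon> x \<subseteq> N"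
    by (meson subset_trans)
qed

lemma seminorm_topology_group:
  assumes "vector_space smul" "\<forall>\<rho>\<in>P. ext_seminorm smul \<rho>"
  defines "\<tau> \<equiv> seminorm_topology P"
  shows "continuous_map (prod_topology \<tau> \<tau>) \<tau> (\<lambda>(x, y). x - y)"
  unfolding continuous_map_def
proof (intro conjI allI impI)
  fix U assume U: "openin \<tau> U"
  show "openin (prod_topology \<tau> \<tau>) {p \<in> topspace (prod_topology \<tau> \<tau>). (case p of (x, y) \<Rightarrow> x - y) \<in> U}"
    unfolding openin_prod_topology_alt
  proof (intro allI impI)
    fix a b assume "(a, b) \<in> {p \<in> topspace (prod_topology \<tau> \<tau>). (case p of (x, y) \<Rightarrow> x - y) \<in> U}"
    then have "a - b \<in> U" by simp
    then obtain J \<epsilon> where J: "finite J" "J \<subseteq> P" "\<epsilon> > 0" "snball J \<epsilon> (a - b) \<subseteq> U"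
      by (rule openin_seminorm_topologyE[OF U[unfolded \<tau>_def]])
    let ?B = "snball J (\<epsilon> / 2)"
    have self: "z \<in> ?B z" for z
      using J assms(2) by (intro snball_self[OF assms(1)]) auto
    have "x - y \<in> U" if "x \<in> ?B a" "y \<in> ?B b" for x y
    proof -
      have "\<rho> ((x - y) - (a - b)) < ennreal \<epsilon>" if \<rho>: "\<rho> \<in> J" for \<rho>
      proof -
        have e: "ext_seminorm smul \<rho>" using assms(2) J \<rho> by blast
        have "\<rho> ((x - a) + - (y - b)) \<le> \<rho> (x - a) + \<rho> (- (y - b))"
          using e unfolding ext_seminorm_def by blast
        also have "\<dots> = \<rho> (x - a) + \<rho> (y - b)"
          by (simp only: ext_seminorm_minus[OF assms(1) e])
        also have "\<dots> < ennreal (\<epsilon> / 2) + ennreal (\<epsilon> / 2)"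
          using \<open>x \<in> ?B a\<close> \<open>y \<in> ?B b\<close> \<rho> by (intro add_strict_mono) (auto simp: snball_def)
        also have "\<dots> = ennreal \<epsilon>" using J(3) by (simp flip: ennreal_plus)
        finally show ?thesis by (simp add: algebra_simps)
      qed
      then show ?thesis using J(4) by (auto simp: snball_def)
    qed
    then show "\<exists>V W. openin \<tau> V \<and> openin \<tau> W \<and> a \<in> V \<and> b \<in> W \<and>
        V \<times> W \<subseteq> {p \<in> topspace (prod_topology \<tau> \<tau>). (case p of (x, y) \<Rightarrow> x - y) \<in> U}"
      using self openin_snball[OF assms(1,2) J(1,2)]
      by (intro exI[of _ "?B a"] exI[of _ "?B b"]) (auto simp: \<tau>_def)
  qed
qed (auto simp: \<tau>_def)

text \<open>The finest locally convex topology exists and is unique.\<close>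

lemma openin_snball_singleton_imp_continuous:
  assumes "vector_space smul" "ext_seminorm smul p" "\<forall>x. p x < \<infinity>"
    and balls: "\<And>x \<epsilon>. openin \<tau> (snball {p} \<epsilon> x)"
  shows "continuous_map \<tau> euclidean p"
proof -
  define r where "r x = enn2real (p x)" for x
  have p: "p x = ennreal (r x)" "r x \<ge> 0" for x
    using assms(3) by (auto simp: r_def less_top)
  have tri: "r (x + y) \<le> r x + r y" for x y
  proof -
    have "p (x + y) \<le> p x + p y" using assms(2) unfolding ext_seminorm_def by blast
    then show ?thesis by (simp add: p flip: ennreal_plus)
  qed
  have sym: "r (x - y) = r (y - x)" for x y
    using ext_seminorm_minus[OF assms(1,2), of "y - x"] by (simp add: r_def)
  have "\<bar>r y - r x\<bar> \<le> r (y - x)" for x y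
    using tri[of "y - x" x] tri[of "x - y" y] sym[of x y] by simp
  moreover have "y \<in> snball {p} \<epsilon> x \<longleftrightarrow> r (y - x) < \<epsilon>" for x y \<epsilon>
    using p by (simp add: snball_def ennreal_less_iff)
  ultimately have near: "y \<in> snball {p} \<epsilon> x \<Longrightarrow> \<bar>r y - r x\<bar> < \<epsilon>" for x y \<epsilon>
    using le_less_trans by blast
  have self: "x \<in> snball {p} \<epsilon> x" if "\<epsilon> > 0" for x \<epsilon>
    using that assms(2) by (intro snball_self[OF assms(1)]) auto
  have "topspace \<tau> = UNIV"
    using self[of 1] openin_subset[OF balls] by fastforce
  have "continuous_map \<tau> euclidean r"
    unfolding continuous_map_def
  proof (intro conjI allI impI)
    fix U :: "real set" assume "openin euclidean U"
    then have U: "open U" by simp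
    show "openin \<tau> {x \<in> topspace \<tau>. r x \<in> U}"
    proof (subst openin_subopen, intro ballI)
      fix x assume "x \<in> {x \<in> topspace \<tau>. r x \<in> U}"
      then obtain e where e: "e > 0" "\<forall>t. dist t (r x) < e \<longrightarrow> t \<in> U"
        using U by (auto simp: open_dist)
      then have "snball {p} e x \<subseteq> {x \<in> topspace \<tau>. r x \<in> U}"
        using near \<open>topspace \<tau> = UNIV\<close> by (auto simp: dist_real_def)
      then show "\<exists>T. openin \<tau> T \<and> x \<in> T \<and> T \<subseteq> {x \<in> topspace \<tau>. r x \<in> U}"
        using balls[of e x] self[OF e(1), of x] by (intro exI[of _ "snball {p} e x"] conjI)
    qed
  qed auto
  moreover have "continuous_map euclidean euclidean ennreal"
    by (auto simp: continuous_on_ennreal)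
  ultimately have "continuous_map \<tau> euclidean (ennreal \<circ> r)"
    by (rule continuous_map_compose)
  moreover have "ennreal \<circ> r = p"
    using p(1) by auto
  ultimately show ?thesis by simp
qed

lemma flc_exists:
  assumes "elcs smul \<tau>"
  shows "\<exists>!\<tau>F. is_flc_topology smul \<tau> \<tau>F"
proof (rule ex_ex1I)
  obtain R where vs: "vector_space smul" and R: "\<forall>\<rho>\<in>R. ext_seminorm smul \<rho>"
    and \<tau>: "\<tau> = seminorm_topology R"
    using assms unfolding elcs_def by blast
  define P where "P = {p. ext_seminorm smul p \<and> (\<forall>x. p x < \<infinity>) \<and> continuous_map \<tau> euclidean p}"
  have "coarser_topology (seminorm_topology P) \<tau>"
    unfolding coarser_topology_def
  proof (intro allI impI)
    fix U assume U: "openin (seminorm_topology P) U"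
    show "openin \<tau> U"
      unfolding \<tau> openin_seminorm_topology
    proof
      fix x assume "x \<in> U"
      then obtain J \<epsilon> where J: "finite J" "J \<subseteq> P" "\<epsilon> > 0" "snball J \<epsilon> x \<subseteq> U"
        by (rule openin_seminorm_topologyE[OF U])
      have "openin \<tau> {y \<in> topspace \<tau>. p y \<in> {..<ennreal \<epsilon>}}" if "p \<in> J" for p
        using J(2) that unfolding P_def by (intro openin_continuous_map_preimage[of \<tau> euclidean]) auto
      then have "openin \<tau> {y. p y < ennreal \<epsilon>}" if "p \<in> J" for p
        using that by (simp add: \<tau>)
      then have "openin \<tau> ((\<Inter>p\<in>J. {y. p y < ennreal \<epsilon>}) \<inter> topspace \<tau>)"
        using J(1) by (cases "J = {}") (auto intro!: openin_Int openin_Inter)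
      moreover have "(\<Inter>p\<in>J. {y. p y < ennreal \<epsilon>}) \<inter> topspace \<tau> = snball J \<epsilon> 0"
        by (auto simp: snball_def \<tau>)
      ultimately have op: "openin \<tau> (snball J \<epsilon> 0)" by simp
      have "0 \<in> snball J \<epsilon> 0"
        using J by (intro snball_self[OF vs]) (auto simp: P_def)
      then obtain K \<delta> where K: "finite K" "K \<subseteq> R" "\<delta> > 0" "snball K \<delta> 0 \<subseteq> snball J \<epsilon> 0"
        by (rule openin_seminorm_topologyE[OF op[unfolded \<tau>]])
      have "snball K \<delta> x \<subseteq> snball J \<epsilon> x"
      proof
        fix y assume "y \<in> snball K \<delta> x"
        then have "y - x \<in> snball K \<delta> 0" by (simp add: snball_def)
        then have "y - x \<in> snball J \<epsilon> 0" using K(4) by blast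
        then show "y \<in> snball J \<epsilon> x" by (simp add: snball_def)
      qed
      then show "\<exists>K \<delta>. finite K \<and> K \<subseteq> R \<and> \<delta> > 0 \<and> snball K \<delta> x \<subseteq> U"
        using J(4) K by blast
    qed
  qed
  moreover have "coarser_topology \<sigma> (seminorm_topology P)"
    if l: "locally_convex_topology smul \<sigma>" and c: "coarser_topology \<sigma> \<tau>" for \<sigma>
  proof -
    obtain Q where Q: "\<forall>\<rho>\<in>Q. ext_seminorm smul \<rho> \<and> (\<forall>x. \<rho> x < \<infinity>)" and \<sigma>: "\<sigma> = seminorm_topology Q"
      using l unfolding locally_convex_topology_def by auto
    have "q \<in> P" if q: "q \<in> Q" for q
    proof -
      have "openin \<tau> (snball {q} \<epsilon> x)" for x \<epsilon>
      proof -
        have "openin \<sigma> (snball {q} \<epsilon> x)"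
          unfolding \<sigma> using Q q by (intro openin_snball[OF vs]) auto
        then show ?thesis using c by (simp add: coarser_topology_def)
      qed
      then have "continuous_map \<tau> euclidean q"
        using Q q by (intro openin_snball_singleton_imp_continuous[OF vs]) auto
      then show ?thesis
        using Q q by (simp add: P_def)
    qed
    then have "Q \<subseteq> P" by (rule subsetI)
    show ?thesis
      unfolding coarser_topology_def
    proof (intro allI impI)
      fix U assume U: "openin \<sigma> U"
      show "openin (seminorm_topology P) U"
        unfolding openin_seminorm_topology
      proof
        fix x assume "x \<in> U"
        then obtain J \<epsilon> where "finite J" "J \<subseteq> Q" "\<epsilon> > 0" "snball J \<epsilon> x \<subseteq> U"
          by (rule openin_seminorm_topologyE[OF U[unfolded \<sigma>]])
        then show "\<exists>J \<epsilon>. finite J \<and> J \<subseteq> P \<and> \<epsilon> > 0 \<and> snball J \<epsilon> x \<subseteq> U"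
          using \<open>Q \<subseteq> P\<close> by (intro exI[of _ J] exI[of _ \<epsilon>]) auto
      qed
    qed
  qed
  moreover have lc: "locally_convex_topology smul (seminorm_topology P)"
    unfolding locally_convex_topology_def by (intro exI[of _ P]) (simp add: P_def)
  ultimately show "\<exists>\<tau>F. is_flc_topology smul \<tau> \<tau>F"
    unfolding is_flc_topology_def
    by (intro exI[of _ "seminorm_topology P"] conjI allI impI)
      (simp_all add: lc)
next
  fix \<sigma> \<sigma>' assume "is_flc_topology smul \<tau> \<sigma>" "is_flc_topology smul \<tau> \<sigma>'"
  then show "\<sigma> = \<sigma>'"
    unfolding is_flc_topology_def coarser_topology_def topology_eq by blast
qed

lemma coset_add:
  assumes "vector_space smul" "module.subspace smul W"
  shows "(x +o W) + (y +o W) = (x + y) +o W"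
proof -
  interpret vector_space smul by fact
  have "W + W = W"
    using assms(2) by (force simp: set_plus_def subspace_def)
  then show ?thesis by (simp add: set_plus_rearrange)
qed

lemma quotient_scale_coset:
  assumes "vector_space smul" "module.subspace smul W"
  shows "quotient_scale smul W c (x +o W) = smul c x +o W"
proof -
  interpret vector_space smul by fact
  have "smul c ` (x +o W) + W \<subseteq> smul c x +o W"
    using assms(2) by (auto simp: set_plus_def elt_set_plus_def subspace_def scale_right_distrib add.assoc)
  moreover have "smul c x +o W \<subseteq> smul c ` (x +o W) + W"
  proof
    fix z assume "z \<in> smul c x +o W"
    then obtain w where w: "w \<in> W" "z = smul c x + w" by (auto simp: elt_set_plus_def)
    moreover have "x \<in> x +o W" using assms(2) by (auto simp: elt_set_plus_def subspace_def intro: exI[of _ 0])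
    ultimately show "z \<in> smul c ` (x +o W) + W" by (auto simp: set_plus_def)
  qed
  ultimately show ?thesis by (auto simp: quotient_scale_def)
qed

end

theory Submission
  imports Defs
begin

text \<open>
  Let \<open>W\<close> be the subspace on which \<open>\<rho>\<close> is finite. Choosing a basis of \<open>W\<close> and extending it to the
  whole space gives a finite seminorm \<open>p\<close> whose kernel is exactly \<open>W\<close>, namely the largest modulus of
  a coordinate outside \<open>W\<close> (\<open>subspace_is_seminorm_kernel\<close>). Continuity of \<open>\<rho>\<close> makes \<open>W\<close> a
  neighborhood of \<open>0\<close>, and \<open>p\<close> does not change along \<open>W\<close>; so \<open>p\<close> is continuous for the given
  topology, however wild it is transversally to \<open>W\<close>
  (\<open>seminorm_null_on_nhd_coarser\<close>). Hence \<open>p\<close> is continuous for the finest locally convex topology,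
  which by hypothesis is the weak topology.

  A weak neighborhood of \<open>0\<close> contains the common kernel of finitely many functionals. If it lies in
  the unit ball of \<open>p\<close>, then \<open>p\<close> is bounded, hence zero, on that kernel, so the kernel is contained in
  \<open>W\<close> (\<open>weakly_open_ball_contains_kernel\<close>). A common kernel of finitely many functionals has finite
  codimension (\<open>finite_codim_common_kernel\<close>), and so has the larger subspace \<open>W\<close>.
\<close>

lemma subspace_fin_part:
  assumes "vector_space smul" "ext_seminorm smul \<rho>"
  shows "module.subspace smul (fin_part \<rho>)"
proof -
  interpret vector_space smul by fact
  have add: "\<rho> (x + y) \<le> \<rho> x + \<rho> y" and scale: "\<rho> (smul c x) = ennreal (norm c) * \<rho> x" for x y c
    using assms(2) unfolding ext_seminorm_def by blast+
  show ?thesis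
  proof (rule subspaceI)
    show "0 \<in> fin_part \<rho>"
      using ext_seminorm_zero[OF assms] by (simp add: fin_part_def)
  next
    fix x y assume "x \<in> fin_part \<rho>" "y \<in> fin_part \<rho>"
    then have "\<rho> x + \<rho> y < \<infinity>" by (simp add: fin_part_def)
    then show "x + y \<in> fin_part \<rho>"
      using le_less_trans[OF add] by (simp add: fin_part_def)
  next
    fix c x assume "x \<in> fin_part \<rho>"
    then show "smul c x \<in> fin_part \<rho>"
      by (simp add: fin_part_def scale ennreal_mult_less_top)
  qed
qed

text \<open>
  The supremum norm of the coordinates in a basis, restricted to the basis vectors outside \<open>W\<close>; it is
  finite because a vector has only finitely many nonzero coordinates.
\<close>

lemma subspace_is_seminorm_kernel:
  fixes smul :: "'k::real_normed_field \<Rightarrow> 'a::ab_group_add \<Rightarrow> 'a"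
  assumes "vector_space smul" "module.subspace smul W"
  obtains p where "ext_seminorm smul p" "\<And>x. p x < \<infinity>" "\<And>x. p x = 0 \<longleftrightarrow> x \<in> W"
proof -
  interpret vector_space smul by fact
  obtain B where B: "B \<subseteq> W" "independent B" "W \<subseteq> span B"
    using maximal_independent_subset[of W] by blast
  have W: "span B = W"
    using B assms(2) span_minimal by blast
  define E where "E = extend_basis B"
  have E: "B \<subseteq> E" "independent E" "span E = UNIV"
    using B(2) by (auto simp: E_def extend_basis_superset independent_extend_basis span_extend_basis)
  define p where "p x = (SUP b\<in>E - B. ennreal (norm (representation E x b)))" for x
  have "p (smul c x) = ennreal (norm c) * p x" for c x
    using E by (simp add: p_def representation_scale norm_mult ennreal_mult SUP_mult_left_ennreal)
  moreover have "p (x + y) \<le> p x + p y" for x y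
    unfolding p_def
  proof (rule SUP_least)
    fix b assume b: "b \<in> E - B"
    have "ennreal (norm (representation E (x + y) b))
        \<le> ennreal (norm (representation E x b)) + ennreal (norm (representation E y b))"
      using E by (simp add: representation_add norm_triangle_ineq flip: ennreal_plus)
    also have "\<dots> \<le> (SUP b\<in>E - B. ennreal (norm (representation E x b)))
        + (SUP b\<in>E - B. ennreal (norm (representation E y b)))"
      using b by (intro add_mono SUP_upper)
    finally show "ennreal (norm (representation E (x + y) b)) \<le> \<dots>" .
  qed
  ultimately have "ext_seminorm smul p"
    by (simp add: ext_seminorm_def)
  moreover have "p x < \<infinity>" for x
  proof -
    let ?N = "\<Sum>b | representation E x b \<noteq> 0. norm (representation E x b)"
    have "norm (representation E x b) \<le> ?N" for b
      using finite_representation[of E x]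
      by (cases "representation E x b = 0") (auto intro!: member_le_sum sum_nonneg)
    then have "p x \<le> ennreal ?N"
      unfolding p_def by (intro SUP_least ennreal_leI)
    then show ?thesis
      by (simp add: le_less_trans)
  qed
  moreover have "p x = 0 \<longleftrightarrow> x \<in> W" for x
  proof
    assume "p x = 0"
    then have "representation E x b = 0" if "b \<in> E - B" for b
      using SUP_upper[OF that, of "\<lambda>b. ennreal (norm (representation E x b))"]
      by (simp add: p_def)
    then have "b \<in> B" if "representation E x b \<noteq> 0" for b
      using that representation_ne_zero by blast
    then have "(\<Sum>b | representation E x b \<noteq> 0. smul (representation E x b) b) \<in> span B"
      by (intro span_sum span_scale span_base) auto
    then show "x \<in> W"
      using sum_nonzero_representation_eq[of E x] E W by simp
  next
    assume "x \<in> W"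
    then have "representation E x = representation B x"
      using W E by (intro representation_extend) auto
    then have "representation E x b = 0" if "b \<in> E - B" for b
      using that representation_ne_zero by fastforce
    then have "p x \<le> 0"
      unfolding p_def by (intro SUP_least) simp
    then show "p x = 0" by simp
  qed
  ultimately show ?thesis
    using that by blast
qed

text \<open>
  Every \<open>p\<close>-ball around \<open>x\<close>, however small, contains the translate of \<open>V\<close> to \<open>x\<close>, and translation
  preserves the basic neighborhoods of a seminorm topology.
\<close>

lemma seminorm_null_on_nhd_coarser:
  assumes "openin (seminorm_topology R) V" "0 \<in> V" "\<And>x. x \<in> V \<Longrightarrow> p x = 0"
  shows "coarser_topology (seminorm_topology {p}) (seminorm_topology R)"
  unfolding coarser_topology_def
proof (intro allI impI)
  fix U assume U: "openin (seminorm_topology {p}) U"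
  obtain J \<delta> where J: "finite J" "J \<subseteq> R" "\<delta> > 0" "snball J \<delta> 0 \<subseteq> V"
    using openin_seminorm_topologyE[OF assms(1,2)] .
  show "openin (seminorm_topology R) U"
    unfolding openin_seminorm_topology
  proof
    fix x assume "x \<in> U"
    then obtain K \<epsilon> where K: "K \<subseteq> {p}" "\<epsilon> > 0" "snball K \<epsilon> x \<subseteq> U"
      by (rule openin_seminorm_topologyE[OF U])
    have "p (y - x) = 0" if "y \<in> snball J \<delta> x" for y
      using that J(4) by (intro assms(3)) (auto simp: snball_def)
    then have "snball J \<delta> x \<subseteq> snball K \<epsilon> x"
      using K(1,2) by (fastforce simp: snball_def)
    then show "\<exists>J \<epsilon>. finite J \<and> J \<subseteq> R \<and> \<epsilon> > 0 \<and> snball J \<epsilon> x \<subseteq> U"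
      using J(1-3) K(3) by blast
  qed
qed

text \<open>
  The neighborhood of \<open>0\<close> given by finitely many functionals contains the subspace on which all of
  them vanish, and a seminorm bounded on a subspace is zero there.
\<close>

lemma weakly_open_ball_contains_kernel:
  fixes smul :: "'k::real_normed_field \<Rightarrow> 'a::ab_group_add \<Rightarrow> 'a"
  assumes "vector_space smul" "ext_seminorm smul p" "\<And>x. p x < \<infinity>"
    and "openin (weak_topology smul \<tau>) (snball {p} 1 0)"
  obtains F where "finite F" "F \<subseteq> continuous_dual smul \<tau>"
    "\<And>x. (\<And>f. f \<in> F \<Longrightarrow> f x = 0) \<Longrightarrow> p x = 0"
proof -
  have "0 \<in> snball {p} 1 0"
    using assms(2) by (intro snball_self[OF assms(1)]) auto
  then obtain J \<epsilon> where J: "finite J" "J \<subseteq> (\<lambda>f x. ennreal (norm (f x))) ` continuous_dual smul \<tau>"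
      "\<epsilon> > 0" "snball J \<epsilon> 0 \<subseteq> snball {p} 1 0"
    by (rule openin_seminorm_topologyE[OF assms(4)[unfolded weak_topology_def]])
  obtain F where F: "F \<subseteq> continuous_dual smul \<tau>" "finite F" "J = (\<lambda>f x. ennreal (norm (f x))) ` F"
    using finite_subset_image[OF J(1,2)] by blast
  have "p x = 0" if x: "\<And>f. f \<in> F \<Longrightarrow> f x = 0" for x
  proof (rule ccontr)
    assume "p x \<noteq> 0"
    then obtain r where r: "p x = ennreal r" "r > 0"
      using assms(3)[of x] by (cases "p x") (auto simp: less_le)
    (* Rescaled to p-value 1, the vector is outside the open unit ball of p. *)
    let ?y = "smul (of_real (1 / r)) x"
    have y: "\<forall>f\<in>F. f ?y = 0"
    proof
      fix f assume "f \<in> F"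
      have "Vector_Spaces.linear smul (*) f"
        using \<open>f \<in> F\<close> F(1) by (auto simp: continuous_dual_def)
      then have "f ?y = of_real (1 / r) * f x"
        by (simp only: Vector_Spaces.linear_iff)
      then show "f ?y = 0" using x[OF \<open>f \<in> F\<close>] by simp
    qed
    have "?y \<in> snball J \<epsilon> 0"
      using J(3) bspec[OF y] by (force simp: F(3) snball_def simp del: of_real_divide)
    then have "p ?y < 1"
      using J(4) by (auto simp: snball_def)
    moreover have "p ?y = ennreal (norm (of_real (1 / r) :: 'k)) * p x"
      using assms(2) unfolding ext_seminorm_def by blast
    then have "p ?y = 1"
      using r by (simp add: norm_divide flip: ennreal_mult)
    ultimately show False by simp
  qed
  then show ?thesis
    using that F(1,2) by blast
qed

text \<open>
  Each functional raises the codimension by at most one: a new functional that does not vanish on the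
  common kernel of the others is nonzero at some vector \<open>z\<close> of it, and correcting by multiples of \<open>z\<close>
  adjusts its value while keeping those of the others.
\<close>

lemma finite_codim_common_kernel:
  assumes "vector_space smul" "finite F" "\<And>f. f \<in> F \<Longrightarrow> Vector_Spaces.linear smul (*) f"
  shows "\<exists>T. finite T \<and> (\<forall>x. \<exists>t\<in>module.span smul T. \<forall>f\<in>F. f (x - t) = 0)"
  using assms(2,3)
proof (induction F)
  case empty
  interpret vector_space smul by fact
  show ?case
    using span_zero by (intro exI[of _ "{}"]) auto
next
  case (insert f F)
  interpret vector_space smul by fact
  have diff: "g (x - y) = g x - g y" and scale: "g (smul c x) = c * g x"
    if "g \<in> insert f F" for g x y c
  proof -
    interpret g: Vector_Spaces.linear smul "(*)" g
      using insert.prems that by blast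
    show "g (x - y) = g x - g y" "g (smul c x) = c * g x"
      by (fact g.diff g.scale)+
  qed
  obtain T where T: "finite T" "\<And>x. \<exists>t\<in>span T. \<forall>g\<in>F. g (x - t) = 0"
    using insert.IH insert.prems by (meson insertI2)
  show ?case
  proof (cases "\<forall>z. (\<forall>g\<in>F. g z = 0) \<longrightarrow> f z = 0")
    case True
    then show ?thesis using T by (metis insertE)
  next
    case False
    then obtain z where z: "\<And>g. g \<in> F \<Longrightarrow> g z = 0" "f z \<noteq> 0" by blast
    have "\<exists>t\<in>span (insert z T). \<forall>g\<in>insert f F. g (x - t) = 0" for x
    proof -
      obtain t where t: "t \<in> span T" "\<And>g. g \<in> F \<Longrightarrow> g (x - t) = 0"
        using T(2) by blast
      let ?t = "t + smul (f (x - t) / f z) z"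
      have "?t \<in> span (insert z T)"
        using t(1) span_mono[OF subset_insertI[of T z]]
        by (intro span_add span_scale) (blast intro: span_base)+
      moreover have "g (x - ?t) = 0" if "g \<in> insert f F" for g
      proof -
        have "g (x - ?t) = g (x - t) - f (x - t) / f z * g z"
          using diff[OF that] scale[OF that] by (metis diff_diff_eq)
        then show ?thesis
          using that t(2)[of g] z(1)[of g] z(2) by (cases "g \<in> F") auto
      qed
      ultimately show ?thesis by blast
    qed
    then show ?thesis using T(1) by (meson finite_insert)
  qed
qed

text \<open>
  Vectors that are distinct may have equal cosets, and then a sum over the set of cosets counts them
  once. So the spanning set is first thinned out to one vector for each coset.
\<close>

lemma finite_dim_quotientI:
  fixes smul :: "'k::real_normed_field \<Rightarrow> 'a::ab_group_add \<Rightarrow> 'a"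
  assumes "vector_space smul" "module.subspace smul W"
    and "finite T" "\<And>x. \<exists>t\<in>module.span smul T. x - t \<in> W"
  shows "finite_dim_quotient smul W"
proof -
  interpret vector_space smul by fact
  have W: "subspace W" by fact
  have coset_eq: "x +o W = y +o W" if "x - y \<in> W" for x y
  proof -
    have "(x - y) +o W = W"
    proof -
      have "v \<in> (x - y) +o W" if "v \<in> W" for v
        using subspace_diff[OF W that \<open>x - y \<in> W\<close>]
        by (auto simp: elt_set_plus_def intro!: bexI[of _ "v - (x - y)"])
      moreover have "v \<in> W" if "v \<in> (x - y) +o W" for v
        using that subspace_add[OF W \<open>x - y \<in> W\<close>] by (auto simp: elt_set_plus_def)
      ultimately show ?thesis by blast
    qed
    then show ?thesis
      using set_plus_rearrange2[of y "x - y" W] by simp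
  qed
  let ?q = "\<lambda>x. x +o W"
  obtain U where U: "U \<subseteq> T" "inj_on ?q U" "?q ` T = ?q ` U"
    using subset_image_inj[of "?q ` T" ?q T] by auto
  have fin: "finite U" using U(1) assms(3) finite_subset by blast
  have sum: "W + (\<Sum>t\<in>A. ?q (g t)) = ?q (\<Sum>t\<in>A. g t)" if "finite A" for A and g :: "'a \<Rightarrow> 'a"
    using that
  proof (induction A)
    case empty
    show ?case by (simp add: set_zero set_plus_def)
  next
    case (insert a A)
    have "W + (\<Sum>t\<in>insert a A. ?q (g t)) = ?q (g a) + (W + (\<Sum>t\<in>A. ?q (g t)))"
      using insert.hyps by (simp add: add.left_commute)
    also have "\<dots> = ?q (g a + (\<Sum>t\<in>A. g t))"
      by (simp only: insert.IH coset_add[OF assms(1,2)])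
    finally show ?case using insert.hyps by simp
  qed
  have span_U: "\<exists>u\<in>span U. t - u \<in> W" if "t \<in> span T" for t
    using that
  proof (induction rule: span_induct_alt)
    case base
    then show ?case using subspace_0[OF W] span_zero by (intro bexI[of _ 0]) auto
  next
    case (step c t y)
    obtain u where u: "u \<in> U" "?q t = ?q u" using U(3) step.hyps by blast
    have "t \<in> ?q t" using subspace_0[OF W] by (auto simp: elt_set_plus_def intro!: bexI[of _ 0])
    then have "t \<in> ?q u" by (simp only: u(2))
    then have "t - u \<in> W" by (auto simp: elt_set_plus_def)
    moreover obtain v where v: "v \<in> span U" "y - v \<in> W" using step.IH by blast
    ultimately have "smul c (t - u) + (y - v) \<in> W"
      using W by (intro subspace_add subspace_scale)
    then have "smul c t + y - (smul c u + v) \<in> W"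
      by (simp add: scale_right_diff_distrib algebra_simps)
    moreover have "smul c u + v \<in> span U"
      using span_add[OF span_scale[OF span_base[OF u(1)]] v(1)] .
    ultimately show ?case by blast
  qed
  have "\<exists>c. ?q x = W + (\<Sum>B\<in>?q ` U. quotient_scale smul W (c B) B)" for x
  proof -
    obtain t where t: "t \<in> span T" "x - t \<in> W" using assms(4) by blast
    obtain u where u: "u \<in> span U" "t - u \<in> W" using span_U[OF t(1)] by blast
    have "x - u \<in> W" using subspace_add[OF W t(2) u(2)] by simp
    obtain d where d: "u = (\<Sum>v\<in>U. smul (d v) v)"
      using u(1) span_finite[OF fin] by auto
    let ?c = "\<lambda>B. d (inv_into U ?q B)"
    have "(\<Sum>B\<in>?q ` U. quotient_scale smul W (?c B) B) = (\<Sum>v\<in>U. ?q (smul (d v) v))"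
    proof -
      have "d (inv_into U ?q (?q v)) = d v" if "v \<in> U" for v
        using inv_into_f_f[OF U(2) that] by simp
      then show ?thesis
        using U(2) by (simp add: sum.reindex quotient_scale_coset[OF assms(1,2)])
    qed
    then have "W + (\<Sum>B\<in>?q ` U. quotient_scale smul W (?c B) B) = ?q u"
      by (simp only: sum[OF fin] d)
    then show ?thesis
      using coset_eq[OF \<open>x - u \<in> W\<close>] by (intro exI[of _ ?c]) simp
  qed
  then show ?thesis
    using fin unfolding finite_dim_quotient_def quotient_space_def
    by (intro exI[of _ "?q ` U"]) auto
qed

theorem proposition3p4:
  fixes smul :: "'k::real_normed_field \<Rightarrow> 'a::ab_group_add \<Rightarrow> 'a"
    and \<tau> \<tau>F :: "'a topology"
  assumes "elcs smul \<tau>"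
    and "is_flc_topology smul \<tau> \<tau>F"
    and "\<tau>F = weak_topology smul \<tau>"
  shows "\<forall>\<rho>. ext_seminorm smul \<rho> \<and> continuous_map \<tau> euclidean \<rho> \<longrightarrow>
    finite_dim_quotient smul (fin_part \<rho>)"
proof (intro allI impI, elim conjE)
  fix \<rho> assume \<rho>: "ext_seminorm smul \<rho>" "continuous_map \<tau> euclidean \<rho>"
  obtain R where vs: "vector_space smul" and \<tau>: "\<tau> = seminorm_topology R"
    using assms(1) unfolding elcs_def by blast
  define W where "W = fin_part \<rho>"
  have W: "module.subspace smul W"
    unfolding W_def by (rule subspace_fin_part[OF vs \<rho>(1)])
  obtain p where p: "ext_seminorm smul p" "\<And>x. p x < \<infinity>" "\<And>x. p x = 0 \<longleftrightarrow> x \<in> W"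
    using subspace_is_seminorm_kernel[OF vs W] by blast
  have "openin \<tau> {x \<in> topspace \<tau>. \<rho> x \<in> {..<\<infinity>}}"
    using \<rho>(2) by (rule openin_continuous_map_preimage) simp
  then have "openin (seminorm_topology R) W"
    by (simp add: \<tau> W_def fin_part_def)
  moreover have "0 \<in> W"
    using ext_seminorm_zero[OF vs \<rho>(1)] by (simp add: W_def fin_part_def)
  ultimately have "coarser_topology (seminorm_topology {p}) \<tau>"
    unfolding \<tau> using p(3) by (intro seminorm_null_on_nhd_coarser) auto
  moreover have "locally_convex_topology smul (seminorm_topology {p})"
    unfolding locally_convex_topology_def using p(1,2) by (intro exI[of _ "{p}"]) auto
  ultimately have "coarser_topology (seminorm_topology {p}) (weak_topology smul \<tau>)"
    using assms(2,3) unfolding is_flc_topology_def by blast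
  moreover have "openin (seminorm_topology {p}) (snball {p} 1 0)"
    using p(1) by (intro openin_snball[OF vs]) auto
  ultimately have "openin (weak_topology smul \<tau>) (snball {p} 1 0)"
    unfolding coarser_topology_def by blast
  then obtain F where F: "finite F" "F \<subseteq> continuous_dual smul \<tau>"
      "\<And>x. (\<And>f. f \<in> F \<Longrightarrow> f x = 0) \<Longrightarrow> p x = 0"
    using weakly_open_ball_contains_kernel[OF vs p(1,2)] by blast
  have "\<exists>T. finite T \<and> (\<forall>x. \<exists>t\<in>module.span smul T. \<forall>f\<in>F. f (x - t) = 0)"
    using F(1,2) by (intro finite_codim_common_kernel[OF vs]) (auto simp: continuous_dual_def)
  then obtain T where T: "finite T" "\<And>x. \<exists>t\<in>module.span smul T. \<forall>f\<in>F. f (x - t) = 0"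
    by blast
  have "\<exists>t\<in>module.span smul T. x - t \<in> W" for x
    using T(2)[of x] F(3) p(3) by blast
  then show "finite_dim_quotient smul (fin_part \<rho>)"
    using finite_dim_quotientI[OF vs W T(1)] by (simp add: W_def)
qed

end
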